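(* For every integer $n\ge 3$, $$2n-2-\sqrt{(4n-8)\ln(4n-4)}\ \le\ a(K_{1,n-1})\ \le\ 2n-2,$$ where $K_{1,n-1}$ is the star with $n-1$ edges.
   Context: For a finite graph $G$ with no isolated vertices, the achievement game of $G$ on $K_N$ is played by Alice and Bob on the edges of the complete graph $K_N$, all initially uncolored: in each round Alice first colors one uncolored edge blue, then Bob colors one uncolored edge red. The player who first completes a copy of $G$ entirely in his or her own color wins; otherwise the game is a draw. The achievement number $a(G)$ is the smallest $N$ for which Alice has a winning strategy in this game on $K_N$. *)

theory Defs
  imports Complex_Main "HOL-Library.Ramsey"
begin

text \<open>A finite simple graph is a pair of its vertex set and its set of (two-element) edges.\<close>

type_synonym 'a graph = "'a set \<times> 'a set set"

definition complete_bipartite :: "nat \<Rightarrow> nat \<Rightarrow> (nat + nat) graph" where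
  "complete_bipartite r s =
     ({..<r} <+> {..<s}, {{Inl i, Inr j} | i j. i < r \<and> j < s})"

text \<open>The edges of \<open>K\<^sub>N\<close>, i.e. the two-element subsets of \<open>{0,\<dots>,N-1}\<close>.\<close>

definition complete_edges :: "nat \<Rightarrow> nat set set" where
  "complete_edges N = nsets {..<N} 2"

text \<open>
  The copy need not be induced. Since the graphs of interest have no isolated vertices, all
  vertices of the copy are endpoints of edges in \<open>C\<close>, so the host vertex set is not mentioned.
\<close>

definition contains_copy :: "'v set set \<Rightarrow> 'a graph \<Rightarrow> bool" where
  "contains_copy C G \<longleftrightarrow>
     (\<exists>f. inj_on f (fst G) \<and> (\<forall>e \<in> snd G. f ` e \<in> C))"

text \<open>
  A history is the list of the edges coloured so far, in the order in which they were coloured.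
  Alice moves at the even positions (counted from \<open>0\<close>), Bob at the odd ones.
\<close>

definition blue :: "'e list \<Rightarrow> 'e set" where
  "blue h = {h ! i | i. i < length h \<and> even i}"

definition red :: "'e list \<Rightarrow> 'e set" where
  "red h = {h ! i | i. i < length h \<and> odd i}"

definition history :: "nat \<Rightarrow> nat set list \<Rightarrow> bool" where
  "history N h \<longleftrightarrow> distinct h \<and> set h \<subseteq> complete_edges N"

text \<open>
  For uniformity a play always continues until all edges are coloured. This does not affect the
  outcome, which is decided by who completes a copy first: Alice wins iff at some moment of the
  play there is a blue copy but not yet a red one.
\<close>

definition full_play :: "nat \<Rightarrow> nat set list \<Rightarrow> bool" where
  "full_play N h \<longleftrightarrow> distinct h \<and> set h = complete_edges N"

definition alice_wins :: "'a graph \<Rightarrow> nat set list \<Rightarrow> bool" where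
  "alice_wins G h \<longleftrightarrow>
     (\<exists>k \<le> length h. contains_copy (blue (take k h)) G \<and> \<not> contains_copy (red (take k h)) G)"

text \<open>
  A strategy for Alice must offer a legal move at every history where it
  is her turn and an uncoloured edge is left.
\<close>

definition alice_strategy :: "nat \<Rightarrow> (nat set list \<Rightarrow> nat set) \<Rightarrow> bool" where
  "alice_strategy N \<sigma> \<longleftrightarrow>
     (\<forall>h. history N h \<and> even (length h) \<and> set h \<noteq> complete_edges N
        \<longrightarrow> \<sigma> h \<in> complete_edges N - set h)"

definition alice_follows :: "(nat set list \<Rightarrow> nat set) \<Rightarrow> nat set list \<Rightarrow> bool" where
  "alice_follows \<sigma> h \<longleftrightarrow> (\<forall>i < length h. even i \<longrightarrow> h ! i = \<sigma> (take i h))"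

definition alice_has_winning_strategy :: "'a graph \<Rightarrow> nat \<Rightarrow> bool" where
  "alice_has_winning_strategy G N \<longleftrightarrow>
     (\<exists>\<sigma>. alice_strategy N \<sigma> \<and>
        (\<forall>h. full_play N h \<and> alice_follows \<sigma> h \<longrightarrow> alice_wins G h))"

text \<open>Meaningful only if some such \<open>N\<close> exists; otherwise \<open>LEAST\<close> is an unspecified number.\<close>

definition achievement_number :: "'a graph \<Rightarrow> nat" where
  "achievement_number G = (LEAST N. alice_has_winning_strategy G N)"

end

theory Submission
  imports Defs
begin

text \<open>
  Write \<open>m = n - 1\<close>. In \<open>K\<^sub>2\<^sub>m\<close> every vertex has degree \<open>2m - 1\<close>, so a completed play contains a
  monochromatic star and there are no draws; strategy stealing then makes Alice the winner.

  For small \<open>N\<close> Bob controls the potential \<open>\<Sum>v. (1 + l)^blue(v) * (1 - l)^red(v)\<close>, where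
  \<open>blue(v)\<close> and \<open>red(v)\<close> count the coloured edges at \<open>v\<close>. After Alice's first move it
  is \<open>N + 2l\<close>, and Bob can prevent it from exceeding this value. A blue star at \<open>v\<close> alone would
  contribute at least \<open>(1 + l)^m * (1 - l)^(N - 1 - m)\<close>, which for a suitable \<open>l\<close> is at least
  \<open>exp ((2m - N + 1)\<^sup>2 / (2 (N - 1)))\<close>.
\<close>

section \<open>Estimates for hyperbolic functions\<close>

lemma tanh_real_le_self:
  fixes x :: real
  assumes "0 \<le> x"
  shows "tanh x \<le> x"
proof -
  have "0 - tanh 0 \<le> x - tanh x"
  proof (rule DERIV_nonneg_imp_nondecreasing[OF assms])
    fix y :: real
    have "((\<lambda>x. x - tanh x) has_real_derivative 1 - (1 - tanh y ^ 2)) (at y)"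
      using cosh_real_nonzero[of y] by (auto intro!: derivative_eq_intros)
    then show "\<exists>d. ((\<lambda>x. x - tanh x) has_real_derivative d) (at y) \<and> 0 \<le> d"
      by (intro exI) auto
  qed
  then show ?thesis by simp
qed

text \<open>Compare logarithms: \<open>x^2 / 2 - ln (cosh x)\<close> vanishes at 0 and has
  derivative \<open>x - tanh x\<close>, which is nonnegative.\<close>

lemma cosh_real_le_exp:
  fixes x :: real
  assumes "0 \<le> x"
  shows "cosh x \<le> exp (x\<^sup>2 / 2)"
proof -
  have "0\<^sup>2 / 2 - ln (cosh 0) \<le> x\<^sup>2 / 2 - ln (cosh x)"
  proof (rule DERIV_nonneg_imp_nondecreasing[OF assms])
    fix y :: real
    assume "0 \<le> y"
    have "((\<lambda>x. x\<^sup>2 / 2 - ln (cosh x)) has_real_derivative y - tanh y) (at y)"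
      using cosh_real_pos[of y] by (auto intro!: derivative_eq_intros simp: tanh_def)
    then show "\<exists>d. ((\<lambda>x. x\<^sup>2 / 2 - ln (cosh x)) has_real_derivative d) (at y) \<and> 0 \<le> d"
      using tanh_real_le_self[OF \<open>0 \<le> y\<close>] by auto
  qed
  then have "ln (cosh x) \<le> x\<^sup>2 / 2" by simp
  then show ?thesis using cosh_real_pos[of x] by (metis exp_le_cancel_iff exp_ln)
qed

text \<open>For \<open>l = tanh t\<close> one has \<open>1 \<plusminus> l = exp (\<plusminus>t) / cosh t\<close>; the choice \<open>t = (2m - M) / M\<close>
  maximises the bound obtained from \<open>cosh t \<le> exp (t\<^sup>2 / 2)\<close>.\<close>

lemma exists_weight:
  fixes m M :: nat
  assumes "0 < M" "m \<le> M" "M \<le> 2 * m"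
  shows "\<exists>l::real. 0 \<le> l \<and> l \<le> 1 \<and>
    exp ((2 * real m - real M)\<^sup>2 / (2 * real M)) \<le> (1 + l) ^ m * (1 - l) ^ (M - m)"
proof -
  define t where "t = (2 * real m - real M) / real M"
  have t0: "0 \<le> t" using assms by (simp add: t_def)
  have c: "cosh t > 0" by (rule cosh_real_pos)
  have e1: "1 + tanh t = exp t / cosh t"
    using c by (simp add: tanh_def field_simps) (simp add: cosh_plus_sinh)
  have e2: "1 - tanh t = exp (-t) / cosh t"
    using c by (simp add: tanh_def field_simps) (simp add: cosh_minus_sinh[symmetric])
  have "(1 + tanh t) ^ m * (1 - tanh t) ^ (M - m)
      = exp (real m * t + real (M - m) * (-t)) / cosh t ^ M"
    unfolding e1 e2 exp_add exp_of_nat_mult power_divide using assms(2)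
    by (simp add: power_add[symmetric])
  also have "real m * t + real (M - m) * (-t) = (2 * real m - real M) * t"
    using assms(2) by (simp add: of_nat_diff algebra_simps)
  also have "exp ((2 * real m - real M) * t) / cosh t ^ M
      \<ge> exp ((2 * real m - real M) * t) / exp (real M * (t\<^sup>2 / 2))"
  proof (rule divide_left_mono)
    show "cosh t ^ M \<le> exp (real M * (t\<^sup>2 / 2))"
      unfolding exp_of_nat_mult using cosh_real_le_exp[OF t0] c by (intro power_mono) auto
  qed (use c in auto)
  also have "exp ((2 * real m - real M) * t) / exp (real M * (t\<^sup>2 / 2))
      = exp ((2 * real m - real M)\<^sup>2 / (2 * real M))"
    unfolding exp_diff[symmetric] using assms(1)
    by (simp add: t_def power2_eq_square field_simps)
  finally show ?thesis
    using t0 tanh_real_lt_1[of t] by (intro exI[of _ "tanh t"]) auto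
qed

section \<open>Coloured edges and histories\<close>

lemma contains_copy_mono: "C \<subseteq> D \<Longrightarrow> contains_copy C G \<Longrightarrow> contains_copy D G"
  unfolding contains_copy_def by blast

lemma nth_append_Collect:
  "{(h @ [e]) ! i | i. i < length (h @ [e]) \<and> P i} =
    (if P (length h) then insert e else id) {h ! i | i. i < length h \<and> P i}"
proof -
  have "{i. i < length (h @ [e]) \<and> P i} =
      (if P (length h) then insert (length h) else id) {i. i < length h \<and> P i}"
    by (auto simp: less_Suc_eq)
  then have "(!) (h @ [e]) ` {i. i < length (h @ [e]) \<and> P i} =
      (if P (length h) then insert e else id) ((!) (h @ [e]) ` {i. i < length h \<and> P i})"
    by simp
  also have "(!) (h @ [e]) ` {i. i < length h \<and> P i} = (!) h ` {i. i < length h \<and> P i}"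
    by (rule image_cong) (auto simp: nth_append)
  finally show ?thesis by (simp add: image_Collect)
qed

lemma blue_append: "blue (h @ [e]) = (if even (length h) then insert e (blue h) else blue h)"
  unfolding blue_def nth_append_Collect by simp

lemma red_append: "red (h @ [e]) = (if even (length h) then red h else insert e (red h))"
  unfolding red_def nth_append_Collect by simp

lemma blue_Un_red: "blue h \<union> red h = set h"
  unfolding blue_def red_def set_conv_nth by blast

lemma blue_Int_red: "distinct h \<Longrightarrow> blue h \<inter> red h = {}"
  unfolding blue_def red_def by (auto simp: nth_eq_iff_index_eq)

lemma blue_Nil [simp]: "blue [] = {}" and red_Nil [simp]: "red [] = {}"
  by (simp_all add: blue_def red_def)

lemma finite_complete_edges: "finite (complete_edges N)"
  unfolding complete_edges_def by (rule finite_imp_finite_nsets) simp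

lemma history_append:
  "history N (h @ [e]) \<longleftrightarrow> history N h \<and> e \<in> complete_edges N - set h"
  unfolding history_def by auto

lemma history_take: "history N h \<Longrightarrow> history N (take k h)"
  unfolding history_def using set_take_subset[of k h] by auto

section \<open>From invariants to plays and strategies\<close>

text \<open>A single play refutes a strategy of Alice, so no strategy for Bob is formed: the play
  grows edge by edge, with \<open>I\<close> holding at all prefixes, until every edge is
  coloured.\<close>

lemma Bob_forces:
  assumes strat: "alice_strategy N \<sigma>"
    and start: "I []"
    and Alice: "\<And>h e. history N h \<Longrightarrow> even (length h) \<Longrightarrow> I h \<Longrightarrow>
        e \<in> complete_edges N - set h \<Longrightarrow> I (h @ [e])"
    and Bob: "\<And>h. history N h \<Longrightarrow> odd (length h) \<Longrightarrow> I h \<Longrightarrow> set h \<noteq> complete_edges N \<Longrightarrow>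
        \<exists>f \<in> complete_edges N - set h. I (h @ [f])"
  obtains h where "full_play N h" "alice_follows \<sigma> h" "\<And>k. I (take k h)"
proof -
  let ?E = "complete_edges N"
  have "\<exists>h. history N h \<and> length h = n \<and> alice_follows \<sigma> h \<and> (\<forall>k. I (take k h))"
    if "n \<le> card ?E" for n
    using that
  proof (induction n)
    case 0
    then show ?case
      using start by (auto simp: history_def alice_follows_def)
  next
    case (Suc n)
    then obtain h where h: "history N h" "length h = n" "alice_follows \<sigma> h" "\<forall>k. I (take k h)"
      by auto
    have Ih: "I h" using h(4)[rule_format, of n] h(2) by simp
    have ne: "set h \<noteq> ?E"
      using h(1,2) Suc.prems by (metis history_def distinct_card not_less_eq_eq order_refl)
    obtain e where e: "e \<in> ?E - set h" "I (h @ [e])" "even n \<longrightarrow> e = \<sigma> h"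
    proof (cases "even n")
      case True
      then have "\<sigma> h \<in> ?E - set h"
        using strat h(1,2) ne unfolding alice_strategy_def by blast
      then show ?thesis using that Alice h(1,2) True Ih by blast
    next
      case False
      then show ?thesis using that Bob[OF h(1) _ Ih ne] h(2) by blast
    qed
    have "history N (h @ [e])" using h(1) e(1) history_append by blast
    moreover have "alice_follows \<sigma> (h @ [e])"
      using h(2,3) e(3) unfolding alice_follows_def by (auto simp: nth_append less_Suc_eq)
    moreover have "I (take k (h @ [e]))" for k
      using h(2,4) e(2) by (cases "k \<le> n") auto
    ultimately show ?case using h(2) by (intro exI[of _ "h @ [e]"]) auto
  qed
  from this[OF order_refl] obtain h where
    h: "history N h" "length h = card ?E" "alice_follows \<sigma> h" "\<forall>k. I (take k h)" by blast
  then have "set h = ?E"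
    by (metis card_subset_eq distinct_card finite_complete_edges history_def)
  then show ?thesis using h that by (auto simp: full_play_def history_def)
qed

lemma Alice_forces:
  assumes start: "I []"
    and Alice: "\<And>h. history N h \<Longrightarrow> even (length h) \<Longrightarrow> I h \<Longrightarrow> set h \<noteq> complete_edges N \<Longrightarrow>
        \<exists>e \<in> complete_edges N - set h. I (h @ [e])"
    and Bob: "\<And>h f. history N h \<Longrightarrow> odd (length h) \<Longrightarrow> I h \<Longrightarrow>
        f \<in> complete_edges N - set h \<Longrightarrow> I (h @ [f])"
  obtains \<sigma> where "alice_strategy N \<sigma>"
    "\<And>h. full_play N h \<Longrightarrow> alice_follows \<sigma> h \<Longrightarrow> I h"
proof
  let ?E = "complete_edges N"
  \<comment> \<open>The implication keeps the choice legal at histories where \<open>I\<close>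
    fails; \<open>alice_strategy\<close> demands a free edge there too.\<close>
  define \<sigma> where "\<sigma> h = (SOME e. e \<in> ?E - set h \<and> (I h \<longrightarrow> I (h @ [e])))" for h
  have \<sigma>: "\<sigma> h \<in> ?E - set h \<and> (I h \<longrightarrow> I (h @ [\<sigma> h]))"
    if "history N h" "even (length h)" "set h \<noteq> ?E" for h
  proof -
    have "\<exists>e. e \<in> ?E - set h \<and> (I h \<longrightarrow> I (h @ [e]))"
      using Alice[OF that(1,2) _ that(3)] that(1,3) unfolding history_def by blast
    then show ?thesis unfolding \<sigma>_def by (rule someI_ex)
  qed
  show "alice_strategy N \<sigma>" unfolding alice_strategy_def using \<sigma> by blast
  fix h assume full: "full_play N h" and follows: "alice_follows \<sigma> h"
  have hist: "history N h" using full by (auto simp: full_play_def history_def)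
  have "I (take k h)" if "k \<le> length h" for k
    using that
  proof (induction k)
    case 0
    then show ?case using start by simp
  next
    case (Suc k)
    then have k: "take (Suc k) h = take k h @ [h ! k]" "k < length h" "length (take k h) = k"
      "I (take k h)"
      by (auto simp: take_Suc_conv_app_nth)
    have fresh: "history N (take k h)" "h ! k \<in> ?E - set (take k h)"
      using history_take[OF hist, of "Suc k"] history_append unfolding k(1) by auto
    show ?case
    proof (cases "even k")
      case True
      then have "h ! k = \<sigma> (take k h)"
        using follows k(2) unfolding alice_follows_def by blast
      then show ?thesis using \<sigma>[OF fresh(1)] True k fresh(2) by auto
    next
      case False
      then show ?thesis using Bob[OF fresh(1) _ k(4) fresh(2)] k by simp
    qed
  qed
  from this[of "length h"] show "I h" by simp
qed

section \<open>Strategy stealing\<close>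

text \<open>The first set belongs to the player whose win is claimed, so swapping the arguments
  exchanges the roles. The nonemptiness premise of \<open>later\<close> keeps a full board, which is
  a draw, from counting as a win vacuously.\<close>

inductive mover_wins :: "'e set \<Rightarrow> ('e set \<Rightarrow> bool) \<Rightarrow> 'e set \<Rightarrow> 'e set \<Rightarrow> bool"
  for E P where
  now: "e \<in> E - X - Y \<Longrightarrow> P (insert e X) \<Longrightarrow> mover_wins E P X Y"
| later: "e \<in> E - X - Y \<Longrightarrow> E - insert e X - Y \<noteq> {} \<Longrightarrow>
    \<forall>f \<in> E - insert e X - Y. \<not> P (insert f Y) \<and> mover_wins E P (insert e X) (insert f Y) \<Longrightarrow>
    mover_wins E P X Y"

definition waiter_wins :: "'e set \<Rightarrow> ('e set \<Rightarrow> bool) \<Rightarrow> 'e set \<Rightarrow> 'e set \<Rightarrow> bool" where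
  "waiter_wins E P X Y \<longleftrightarrow>
     E - X - Y \<noteq> {} \<and> (\<forall>f \<in> E - X - Y. \<not> P (insert f Y) \<and> mover_wins E P X (insert f Y))"

lemma mover_wins_iff:
  "mover_wins E P X Y \<longleftrightarrow>
    (\<exists>e \<in> E - X - Y. P (insert e X) \<or> waiter_wins E P (insert e X) Y)"
proof
  assume "mover_wins E P X Y"
  then show "\<exists>e \<in> E - X - Y. P (insert e X) \<or> waiter_wins E P (insert e X) Y"
  proof cases
    case (now e)
    then show ?thesis by blast
  next
    case (later e)
    then have "waiter_wins E P (insert e X) Y" unfolding waiter_wins_def by simp
    then show ?thesis using later(1) by blast
  qed
next
  assume "\<exists>e \<in> E - X - Y. P (insert e X) \<or> waiter_wins E P (insert e X) Y"
  then obtain e where "e \<in> E - X - Y" "P (insert e X) \<or> waiter_wins E P (insert e X) Y"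
    by blast
  then show "mover_wins E P X Y"
    unfolding waiter_wins_def using mover_wins.now mover_wins.later by metis
qed

text \<open>Play the two supposed winning strategies against each other. The mover's game tree is
  well-founded, so descending it ends with one player completing \<open>P\<close> where the other's
  claim forbids it.\<close>

lemma not_both_win: "mover_wins E P X Y \<Longrightarrow> \<not> waiter_wins E P Y X"
proof (induction rule: mover_wins.induct)
  case (now e X Y)
  then show ?case unfolding waiter_wins_def by blast
next
  case (later e X Y)
  show ?case
  proof
    assume "waiter_wins E P Y X"
    then have "mover_wins E P Y (insert e X)"
      using later(1) unfolding waiter_wins_def by blast
    then obtain f where "f \<in> E - Y - insert e X"
      "P (insert f Y) \<or> waiter_wins E P (insert f Y) (insert e X)"
      unfolding mover_wins_iff[of E P Y] by blast
    then show False using later(3) by blast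
  qed
qed

text \<open>The three claims are proved by one induction: if the extra edge \<open>g\<close> is what the strategy
  prescribes next, the player has a free tempo, which is spent on an arbitrary edge.\<close>

lemma extra_move_harmless:
  assumes fin: "finite E" and mono: "\<And>C D. C \<subseteq> D \<Longrightarrow> P C \<Longrightarrow> P D"
  shows "(waiter_wins E P X Y \<longrightarrow> mover_wins E P X Y) \<and>
    (\<forall>g \<in> E - X - Y. waiter_wins E P X Y \<longrightarrow> P (insert g X) \<or> waiter_wins E P (insert g X) Y) \<and>
    (\<forall>g \<in> E - X - Y. mover_wins E P X Y \<longrightarrow> P (insert g X) \<or> mover_wins E P (insert g X) Y)"
proof (induction "card (E - X - Y)" arbitrary: X Y rule: less_induct)
  case less
  have smaller: "card (E - insert g X - Y) < card (E - X - Y)"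
    "card (E - X - insert g Y) < card (E - X - Y)" if "g \<in> E - X - Y" for g
    using that by (auto intro!: psubset_card_mono simp: fin simp del: card_Diff_insert)
  have waiter: "P (insert g X) \<or> waiter_wins E P (insert g X) Y"
    if g: "g \<in> E - X - Y" and wins: "waiter_wins E P X Y" for g
  proof (rule disjCI)
    assume no: "\<not> waiter_wins E P (insert g X) Y"
    show "P (insert g X)"
    proof (cases "E - insert g X - Y = {}")
      \<comment> \<open>If \<open>g\<close> is the last free edge, the opponent could take it and
        leave no move, so the assumed win was impossible.\<close>
      case True
      then have "\<not> mover_wins E P X (insert g Y)"
        unfolding mover_wins_iff[of E P X] by blast
      then show ?thesis using wins g unfolding waiter_wins_def by blast
    next
      case False
      \<comment> \<open>\<open>f\<close> is a reply that spoils the position with \<open>g\<close>.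
        The third claim, on the smaller board after \<open>f\<close>, then leaves only
        \<open>P (insert g X)\<close>.\<close>
      then obtain f where f: "f \<in> E - insert g X - Y"
        "P (insert f Y) \<or> \<not> mover_wins E P (insert g X) (insert f Y)"
        using no unfolding waiter_wins_def by blast
      then have f': "f \<in> E - X - Y" "g \<in> E - X - insert f Y" using g by auto
      then have "\<not> P (insert f Y)" "mover_wins E P X (insert f Y)"
        using wins unfolding waiter_wins_def by auto
      then show ?thesis using less[OF smaller(2)[OF f'(1)]] f(2) f'(2) by blast
    qed
  qed
  \<comment> \<open>A waiting player who is given the move may take any free edge as the extra
    one.\<close>
  have "mover_wins E P X Y" if wins: "waiter_wins E P X Y"
    using waiter[OF _ wins] wins unfolding waiter_wins_def mover_wins_iff[of E P X Y] by blast
  moreover have "P (insert g X) \<or> mover_wins E P (insert g X) Y"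
    if g: "g \<in> E - X - Y" and wins: "mover_wins E P X Y" for g
  proof -
    obtain e where e: "e \<in> E - X - Y" "P (insert e X) \<or> waiter_wins E P (insert e X) Y"
      using wins unfolding mover_wins_iff[of E P X Y] by blast
    show ?thesis
    proof (cases "e = g")
      case True
      then show ?thesis using less[OF smaller(1)[OF g]] e(2) by blast
    next
      case False
      \<comment> \<open>The prescribed \<open>e\<close> is still played; the second claim, on the
        board after \<open>e\<close>, carries the extra edge \<open>g\<close> along.\<close>
      then have ge: "g \<in> E - insert e X - Y" "e \<in> E - insert g X - Y" using g e(1) by auto
      have "P (insert e X) \<Longrightarrow> P (insert e (insert g X))" by (erule mono[rotated]) auto
      then have "P (insert e (insert g X)) \<or> waiter_wins E P (insert e (insert g X)) Y"
        using less[OF smaller(1)[OF e(1)]] e(2) ge(1) by (metis insert_commute)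
      then show ?thesis using ge(2) unfolding mover_wins_iff[of E P "insert g X"] by blast
    qed
  qed
  ultimately show ?case using waiter by blast
qed

text \<open>When both hold the same set, the position looks alike to the two players. A win for the
  waiter would, by the extra move, be a win for the mover as well, and \<open>not_both_win\<close>
  forbids having both.\<close>

lemma strategy_stealing:
  assumes "finite E" "\<And>C D. C \<subseteq> D \<Longrightarrow> P C \<Longrightarrow> P D"
  shows "\<not> waiter_wins E P X X"
proof -
  have "waiter_wins E P X X \<longrightarrow> mover_wins E P X X"
    by (rule conjunct1[OF extra_move_harmless]) (fact assms)+
  then show ?thesis using not_both_win[of E P X X] by blast
qed

text \<open>Without draws it suffices that Alice never reaches a position lost for her.\<close>

lemma alice_wins_if_no_draw:
  assumes no_draw: "\<And>h. full_play N h \<Longrightarrow>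
      contains_copy (blue h) G \<or> contains_copy (red h) G"
    and nonempty: "\<not> contains_copy ({} :: nat set set) G"
  shows "alice_has_winning_strategy G N"
proof -
  let ?E = "complete_edges N" and ?P = "\<lambda>C. contains_copy C G"
  \<comment> \<open>Plays go on after a win, hence the first disjunct. In the second, nobody has a
    copy yet and Bob, who owns the red set, has no forced win.\<close>
  define I where "I h \<longleftrightarrow> alice_wins G h \<or> \<not> ?P (blue h) \<and> \<not> ?P (red h) \<and>
    (if even (length h) then \<not> waiter_wins ?E ?P (red h) (blue h)
     else \<not> mover_wins ?E ?P (red h) (blue h))" for h
  have mono: "alice_wins G (h @ [e])" if "alice_wins G h" for h e
    using that unfolding alice_wins_def
  proof (elim exE conjE)
    fix k assume "k \<le> length h" "?P (blue (take k h))" "\<not> ?P (red (take k h))"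
    then show "\<exists>k \<le> length (h @ [e]).
        ?P (blue (take k (h @ [e]))) \<and> \<not> ?P (red (take k (h @ [e])))"
      by (intro exI[of _ k]) simp
  qed
  have free: "?E - red h - blue h = ?E - set h" "?E - blue h - red h = ?E - set h" for h
    using blue_Un_red[of h] by auto
  obtain \<sigma> where \<sigma>: "alice_strategy N \<sigma>" "\<And>h. full_play N h \<Longrightarrow> alice_follows \<sigma> h \<Longrightarrow> I h"
  proof (rule Alice_forces)
    have "\<not> waiter_wins ?E ?P {} {}"
      by (rule strategy_stealing[OF finite_complete_edges contains_copy_mono])
    then show "I []" using nonempty unfolding I_def by simp
  next
    fix h assume h: "history N h" "even (length h)" "I h" "set h \<noteq> ?E"
    show "\<exists>e \<in> ?E - set h. I (h @ [e])"
    proof (cases "alice_wins G h")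
      case True
      then show ?thesis using h(1,4) mono unfolding I_def history_def by blast
    next
      case False
      then have inv: "\<not> ?P (blue h)" "\<not> ?P (red h)" "\<not> waiter_wins ?E ?P (red h) (blue h)"
        using h(2,3) unfolding I_def by auto
      have "?E - set h \<noteq> {}" using h(1,4) unfolding history_def by blast
      then obtain e where e: "e \<in> ?E - set h"
        "?P (insert e (blue h)) \<or> \<not> mover_wins ?E ?P (red h) (insert e (blue h))"
        using inv(3) unfolding waiter_wins_def free by blast
      have b: "blue (h @ [e]) = insert e (blue h)" "red (h @ [e]) = red h"
        using h(2) by (simp_all add: blue_append red_append)
      have "alice_wins G (h @ [e])" if "?P (insert e (blue h))"
        unfolding alice_wins_def using that inv(2) b by (intro exI[of _ "Suc (length h)"]) simp
      then have "I (h @ [e])" using inv e(2) h(2) unfolding I_def b by auto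
      then show ?thesis using e(1) by blast
    qed
  next
    fix h f assume h: "history N h" "odd (length h)" "I h" "f \<in> ?E - set h"
    show "I (h @ [f])"
    proof (cases "alice_wins G h")
      case True
      then show ?thesis using mono unfolding I_def by blast
    next
      case False
      then have inv: "\<not> ?P (blue h)" "\<not> ?P (red h)" "\<not> mover_wins ?E ?P (red h) (blue h)"
        using h(2,3) unfolding I_def by auto
      have "\<not> ?P (insert f (red h))" "\<not> waiter_wins ?E ?P (insert f (red h)) (blue h)"
        using inv(3) h(4) unfolding mover_wins_iff free by blast+
      then show ?thesis using inv(1) h(2) unfolding I_def by (simp add: blue_append red_append)
    qed
  qed blast
  \<comment> \<open>A full play contains a copy in one of the colours, which rules out the second
    disjunct of \<open>I\<close>.\<close>
  have "alice_wins G h" if "full_play N h" "alice_follows \<sigma> h" for h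
    using \<sigma>(2)[OF that] no_draw[OF that(1)] unfolding I_def by blast
  then show ?thesis using \<sigma>(1) unfolding alice_has_winning_strategy_def by blast
qed

section \<open>Degrees and stars\<close>

definition deg :: "'v set set \<Rightarrow> 'v \<Rightarrow> nat" where
  "deg C v = card {e \<in> C. v \<in> e}"

lemma deg_empty [simp]: "deg {} v = 0"
  by (simp add: deg_def)

lemma deg_insert:
  assumes "finite C" "e \<notin> C"
  shows "deg (insert e C) v = deg C v + (if v \<in> e then 1 else 0)"
proof -
  have "{x \<in> insert e C. v \<in> x} = (if v \<in> e then insert e else id) {x \<in> C. v \<in> x}" by auto
  then show ?thesis using assms by (simp add: deg_def)
qed

lemma deg_mono: "finite D \<Longrightarrow> C \<subseteq> D \<Longrightarrow> deg C v \<le> deg D v"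
  unfolding deg_def by (intro card_mono) auto

lemma deg_Un_disjoint:
  assumes "finite C" "finite D" "C \<inter> D = {}"
  shows "deg (C \<union> D) v = deg C v + deg D v"
proof -
  have "{e \<in> C \<union> D. v \<in> e} = {e \<in> C. v \<in> e} \<union> {e \<in> D. v \<in> e}" by auto
  then show ?thesis unfolding deg_def using assms by (simp add: card_Un_disjoint disjoint_iff)
qed

lemma deg_complete_edges:
  assumes "v < N"
  shows "deg (complete_edges N) v = N - 1"
proof -
  have "{e \<in> complete_edges N. v \<in> e} = (\<lambda>w. {v, w}) ` ({..<N} - {v})"
    using assms unfolding complete_edges_def nsets_2_eq by auto
  moreover have "inj_on (\<lambda>w. {v, w}) ({..<N} - {v})"
    by (auto simp: inj_on_def doubleton_eq_iff)
  ultimately show ?thesis using assms by (simp add: deg_def card_image)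
qed

lemma deg_blue_red:
  assumes "distinct h"
  shows "deg (blue h) v + deg (red h) v = deg (set h) v"
proof -
  have "finite (blue h)" "finite (red h)"
    using blue_Un_red[of h] by (metis List.finite_set finite_Un)+
  then show ?thesis
    using deg_Un_disjoint[of "blue h" "red h" v] blue_Int_red[OF assms] blue_Un_red[of h] by simp
qed

lemma contains_star_alt:
  "contains_copy C (complete_bipartite 1 m) \<longleftrightarrow>
    (\<exists>f :: nat + nat \<Rightarrow> _. inj_on f ({..<1} <+> {..<m}) \<and> (\<forall>j<m. {f (Inl 0), f (Inr j)} \<in> C))"
proof -
  have "{{Inl i, Inr j} | i j. i < 1 \<and> j < m} = (\<lambda>j. {Inl (0::nat), Inr j}) ` {..<m}"
    by auto
  then show ?thesis unfolding contains_copy_def complete_bipartite_def by simp (simp add: Ball_def)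
qed

text \<open>Leaves correspond to edges at the centre, distinct leaves to distinct edges. The bound
  on \<open>m\<close> matters: the edge to leaf 0 forces the centre below \<open>N\<close>.\<close>

lemma contains_star_iff:
  assumes "C \<subseteq> complete_edges N" "m \<ge> 1"
  shows "contains_copy C (complete_bipartite 1 m) \<longleftrightarrow> (\<exists>v<N. m \<le> deg C v)"
proof
  have fin: "finite C" using assms(1) finite_complete_edges finite_subset by blast
  assume "contains_copy C (complete_bipartite 1 m)"
  then obtain f :: "nat + nat \<Rightarrow> nat" where
    f: "inj_on f ({..<1} <+> {..<m})" "\<And>j. j < m \<Longrightarrow> {f (Inl 0), f (Inr j)} \<in> C"
    unfolding contains_star_alt by metis
  have "f (Inl 0) < N"
    using f(2)[of 0] assms unfolding complete_edges_def by auto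
  moreover have "inj_on (\<lambda>j. {f (Inl 0), f (Inr j)}) {..<m}"
    using f(1) by (auto simp: inj_on_def doubleton_eq_iff)
  then have "m \<le> deg C (f (Inl 0))"
    unfolding deg_def using f(2) fin
    by (intro card_inj_on_le[of _ "{..<m}", simplified]) auto
  ultimately show "\<exists>v<N. m \<le> deg C v" by blast
next
  assume "\<exists>v<N. m \<le> deg C v"
  then obtain v where "m \<le> deg C v" by blast
  then obtain S where S: "S \<subseteq> {e \<in> C. v \<in> e}" "card S = m" "finite S"
    unfolding deg_def by (meson obtain_subset_with_card_n)
  then obtain g where g: "bij_betw g {..<m} S"
    by (metis bij_betw_iff_card card_lessThan finite_lessThan)
  have "\<exists>w. w \<noteq> v \<and> g j = {v, w}" if "j < m" for j
  proof -
    have "g j \<in> complete_edges N" "v \<in> g j"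
      using g that S(1) assms(1) unfolding bij_betw_def by auto
    then show ?thesis unfolding complete_edges_def nsets_2_eq by (auto simp: insert_commute)
  qed
  then obtain w where w: "\<And>j. j < m \<Longrightarrow> w j \<noteq> v \<and> g j = {v, w j}" by metis
  then have w': "j < m \<Longrightarrow> w j \<noteq> v" "j < m \<Longrightarrow> v \<noteq> w j" for j by metis+
  have "inj_on w {..<m}"
    using g w unfolding bij_betw_def inj_on_def by (metis lessThan_iff)
  then have "inj_on (case_sum (\<lambda>_. v) w) ({..<1::nat} <+> {..<m})"
    using w' by (auto intro!: inj_onI dest: inj_onD)
  moreover have "{v, w j} \<in> C" if "j < m" for j
    using g w S(1) that unfolding bij_betw_def by auto
  ultimately show "contains_copy C (complete_bipartite 1 m)"
    unfolding contains_star_alt by (intro exI[of _ "case_sum (\<lambda>_. v) w"]) simp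
qed

section \<open>Bob's potential\<close>

text \<open>\<open>X\<close> plays the part of the blue edges and \<open>Y\<close> of the red ones.
  Since \<open>1 + l\<close> and \<open>1 - l\<close> average to 1, colouring an edge by a fair coin
  would leave the expected weight unchanged; Bob's strategy derandomises this.\<close>

definition weight :: "real \<Rightarrow> 'v set set \<Rightarrow> 'v set set \<Rightarrow> 'v \<Rightarrow> real" where
  "weight l X Y v = (1 + l) ^ deg X v * (1 - l) ^ deg Y v"

lemma weight_nonneg: "0 \<le> l \<Longrightarrow> l \<le> 1 \<Longrightarrow> 0 \<le> weight l X Y v"
  by (simp add: weight_def)

lemma weight_antimono_red:
  assumes "0 \<le> l" "l \<le> 1" "finite Y'" "Y \<subseteq> Y'"
  shows "weight l X Y' v \<le> weight l X Y v"
  unfolding weight_def using assms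
  by (intro mult_left_mono power_decreasing deg_mono) auto

definition potential :: "nat \<Rightarrow> real \<Rightarrow> nat set set \<Rightarrow> nat set set \<Rightarrow> real" where
  "potential N l X Y = (\<Sum>v<N. weight l X Y v)"

lemma sum_if_edge:
  assumes "e \<in> complete_edges N"
  shows "(\<Sum>v<N. if v \<in> e then g v else 0) = (sum g e :: real)"
proof -
  have "{..<N} \<inter> e = e" using assms unfolding complete_edges_def nsets_def by auto
  then show ?thesis using sum.inter_restrict[of "{..<N}" g e] by simp
qed

text \<open>The change is linear in the weights of the two ends and has the same factor
  \<open>l\<close> as the decrease caused by a red edge, so Alice's gain on one edge is comparable
  with Bob's on another.\<close>

lemma potential_insert_blue:
  assumes "finite X" "e \<notin> X" "e \<in> complete_edges N"
  shows "potential N l (insert e X) Y = potential N l X Y + l * (\<Sum>v\<in>e. weight l X Y v)"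
proof -
  have "weight l (insert e X) Y v = weight l X Y v + (if v \<in> e then l * weight l X Y v else 0)" for v
    using assms by (simp add: weight_def deg_insert algebra_simps)
  then show ?thesis
    using assms(3) by (simp add: potential_def sum.distrib sum_if_edge sum_distrib_left)
qed

lemma potential_insert_red:
  assumes "finite Y" "e \<notin> Y" "e \<in> complete_edges N"
  shows "potential N l X (insert e Y) = potential N l X Y - l * (\<Sum>v\<in>e. weight l X Y v)"
proof -
  have "weight l X (insert e Y) v = weight l X Y v - (if v \<in> e then l * weight l X Y v else 0)" for v
    using assms by (simp add: weight_def deg_insert algebra_simps)
  then show ?thesis
    using assms(3) by (simp add: potential_def sum_subtractf sum_if_edge sum_distrib_left)
qed

text \<open>Bob takes the free edge of maximal weight: his gain is then at least what Alice adds with her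
  next move, because red edges only decrease weights. The bound thus refers to the position after
  Alice's next move.\<close>

lemma Bob_reply:
  assumes l: "0 \<le> l" "l \<le> 1"
    and fin: "finite X" "finite Y"
    and free: "complete_edges N - X - Y \<noteq> {}"
  obtains f where "f \<in> complete_edges N - X - Y"
    "potential N l X (insert f Y) \<le> potential N l X Y"
    "\<And>e. e \<in> complete_edges N - X - insert f Y \<Longrightarrow>
       potential N l (insert e X) (insert f Y) \<le> potential N l X Y"
proof -
  let ?F = "complete_edges N - X - Y" and ?g = "\<lambda>e. \<Sum>v\<in>e. weight l X Y v"
  have fin_im: "finite (?g ` ?F)" using finite_complete_edges by auto
  moreover have "?g ` ?F \<noteq> {}" using free by (subst image_is_empty)
  ultimately have "Max (?g ` ?F) \<in> ?g ` ?F" by (rule Max_in)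
  then obtain f where f: "f \<in> ?F" "?g f = Max (?g ` ?F)" by (metis imageE)
  have red: "potential N l X (insert f Y) = potential N l X Y - l * ?g f"
    using f(1) fin by (intro potential_insert_red) auto
  have "potential N l (insert e X) (insert f Y) \<le> potential N l X Y"
    if e: "e \<in> complete_edges N - X - insert f Y" for e
  proof -
    have "(\<Sum>v\<in>e. weight l X (insert f Y) v) \<le> ?g e"
      using l fin by (intro sum_mono weight_antimono_red) auto
    also have "\<dots> \<le> ?g f" unfolding f(2) using e by (intro Max_ge[OF fin_im] imageI) auto
    finally have "l * (\<Sum>v\<in>e. weight l X (insert f Y) v) \<le> l * ?g f"
      using l(1) by (rule mult_left_mono)
    then show ?thesis using e fin red by (simp add: potential_insert_blue)
  qed
  moreover have "0 \<le> l * ?g f"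
    using l by (intro mult_nonneg_nonneg sum_nonneg weight_nonneg)
  ultimately show ?thesis using that f(1) red by simp
qed

lemma no_win_if_weight_large:
  assumes l: "0 \<le> l" "l \<le> 1" and "m \<ge> 1"
    and large: "m \<le> N - 1 \<Longrightarrow> real N + 2 * l < (1 + l) ^ m * (1 - l) ^ (N - 1 - m)"
  shows "\<not> alice_has_winning_strategy (complete_bipartite 1 m) N"
proof
  let ?E = "complete_edges N" and ?C = "real N + 2 * l"
  \<comment> \<open>When Alice is to move, the bound is required one move ahead, so that each of her
    moves preserves \<open>I\<close> by definition.\<close>
  define I where "I h \<longleftrightarrow> potential N l (blue h) (red h) \<le> ?C \<and> (even (length h) \<longrightarrow>
    (\<forall>e \<in> ?E - set h. potential N l (insert e (blue h)) (red h) \<le> ?C))" for h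
  assume "alice_has_winning_strategy (complete_bipartite 1 m) N"
  then obtain \<sigma> where \<sigma>: "alice_strategy N \<sigma>"
    "\<And>h. full_play N h \<Longrightarrow> alice_follows \<sigma> h \<Longrightarrow> alice_wins (complete_bipartite 1 m) h"
    unfolding alice_has_winning_strategy_def by blast
  have fin: "finite (blue h)" "finite (red h)" for h :: "nat set list"
    using blue_Un_red[of h] by (metis List.finite_set finite_Un)+
  obtain h where h: "full_play N h" "alice_follows \<sigma> h" "\<And>k. I (take k h)"
  proof (rule Bob_forces[OF \<sigma>(1), of I])
    \<comment> \<open>All weights start at 1, and the first blue edge adds \<open>l\<close> at each
      of its two ends: this is the source of \<open>N + 2 * l\<close>.\<close>
    have "potential N l {} {} = real N" by (simp add: potential_def weight_def)
    moreover have "(\<Sum>v\<in>e. weight l {} {} v) = 2" if "e \<in> ?E" for e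
      using that by (simp add: weight_def complete_edges_def nsets_def)
    ultimately show "I []"
      using l(1) unfolding I_def by (simp add: potential_insert_blue)
  next
    fix h e assume "even (length h)" "I h" "e \<in> ?E - set h"
    then show "I (h @ [e])" unfolding I_def by (simp add: blue_append red_append)
  next
    fix h assume h: "history N h" "odd (length h)" "I h" "set h \<noteq> ?E"
    have free: "?E - blue h - insert f (red h) = ?E - insert f (set h)"
      "?E - blue h - red h = ?E - set h" for f
      using blue_Un_red[of h] by auto
    have "?E - blue h - red h \<noteq> {}" using h(1,4) unfolding free history_def by blast
    from Bob_reply[OF l fin this] obtain f where "f \<in> ?E - set h"
      "potential N l (blue h) (insert f (red h)) \<le> potential N l (blue h) (red h)"
      "\<And>e. e \<in> ?E - insert f (set h) \<Longrightarrow>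
        potential N l (insert e (blue h)) (insert f (red h)) \<le> potential N l (blue h) (red h)"
      unfolding free by metis
    then show "\<exists>f \<in> ?E - set h. I (h @ [f])"
      using h(2,3) unfolding I_def by (intro bexI[of _ f]) (force simp: blue_append red_append)+
  qed blast
  from \<sigma>(2)[OF h(1,2)] obtain k where
    k: "contains_copy (blue (take k h)) (complete_bipartite 1 m)"
    unfolding alice_wins_def by blast
  \<comment> \<open>The star may appear in mid-play, with edges at its centre still uncoloured. At
    least \<open>m\<close> blue and hence at most \<open>N - 1 - m\<close> red edges there already
    suffice, because \<open>1 + l\<close> is at least 1 and \<open>1 - l\<close> at most 1.\<close>
  define g where "g = take k h"
  have g: "distinct g" "set g \<subseteq> ?E"
    using h(1) set_take_subset[of k h] unfolding g_def full_play_def by auto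
  then obtain v where v: "v < N" "m \<le> deg (blue g) v"
    using k contains_star_iff[of "blue g" N m] \<open>m \<ge> 1\<close> blue_Un_red[of g] unfolding g_def by auto
  have sum: "deg (blue g) v + deg (red g) v \<le> N - 1"
    using deg_blue_red[OF g(1), of v] deg_mono[OF finite_complete_edges g(2), of v]
      deg_complete_edges[OF v(1)] by simp
  have "?C < (1 + l) ^ m * (1 - l) ^ (N - 1 - m)" using large v(2) sum by simp
  also have "\<dots> \<le> weight l (blue g) (red g) v"
    unfolding weight_def using l v(2) sum
    by (intro mult_mono power_increasing power_decreasing) auto
  also have "\<dots> \<le> potential N l (blue g) (red g)"
    unfolding potential_def using v(1) l by (intro member_le_sum) (auto intro: weight_nonneg)
  also have "\<dots> \<le> ?C" using h(3)[of k] unfolding I_def g_def by simp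
  finally show False by simp
qed

section \<open>The two bounds for stars\<close>

lemma star_lower_bound:
  assumes "m \<ge> 2" and win: "alice_has_winning_strategy (complete_bipartite 1 m) N"
  shows "2 * real m - sqrt ((4 * real m - 4) * ln (4 * real m)) \<le> real N"
proof (rule ccontr)
  let ?B = "(4 * real m - 4) * ln (4 * real m)"
  assume "\<not> ?thesis"
  then have k: "sqrt ?B < 2 * real m - real N" by simp
  have B0: "0 \<le> ?B" using assms(1) by simp
  then have N: "real N < 2 * real m" using k by (meson diff_gt_0_iff_gt le_less_trans real_sqrt_ge_zero)
  show False
  proof (cases "m \<le> N - 1")
    \<comment> \<open>Every degree is below \<open>m\<close>, so the condition on \<open>l\<close>
      is vacuous and \<open>l = 0\<close> will do.\<close>
    case False
    then show ?thesis using no_win_if_weight_large[of 0 m N] assms by simp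
  next
    case True
    let ?M = "N - 1"
    have M: "0 < ?M" "?M \<le> 2 * m" "real ?M = real N - 1" using True assms(1) N by auto
    from exists_weight[OF M(1) True M(2)] obtain l where l: "0 \<le> l" "l \<le> 1"
      "exp ((2 * real m - real ?M)\<^sup>2 / (2 * real ?M)) \<le> (1 + l) ^ m * (1 - l) ^ (?M - m)" by blast
    \<comment> \<open>Integrality gives \<open>?M \<le> 2 * m - 2\<close>; this accounts for the
      factor \<open>4 * m - 4\<close> under the root.\<close>
    have "N + 1 \<le> 2 * m" using N by linarith
    then have "2 * real ?M \<le> 4 * real m - 4" using M(3) by linarith
    then have "ln (4 * real m) * (2 * real ?M) \<le> ln (4 * real m) * (4 * real m - 4)"
      using assms(1) by (intro mult_left_mono) auto
    also have "\<dots> = (sqrt ?B)\<^sup>2" using B0 by (simp add: mult.commute)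
    also have "\<dots> < (2 * real m - real N)\<^sup>2"
      using k B0 by (intro power_strict_mono) auto
    also have "\<dots> \<le> (2 * real m - real ?M)\<^sup>2"
      using M(3) N by (intro power_mono) auto
    finally have "ln (4 * real m) < (2 * real m - real ?M)\<^sup>2 / (2 * real ?M)"
      using M(1) by (subst pos_less_divide_eq) auto
    then have "4 * real m < exp ((2 * real m - real ?M)\<^sup>2 / (2 * real ?M))"
      using assms(1) by (metis exp_less_mono exp_ln mult_pos_pos of_nat_0_less_iff
          zero_less_numeral less_le_trans)
    \<comment> \<open>Bob's bound is less than \<open>2 * m + 2\<close>, hence at most
      \<open>4 * m\<close>, the argument of the logarithm.\<close>
    moreover have "real N + 2 * l \<le> 4 * real m" using N l(2) assms(1) by simp
    ultimately have "real N + 2 * l < (1 + l) ^ m * (1 - l) ^ (?M - m)" using l(3) by linarith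
    then show ?thesis using no_win_if_weight_large[OF l(1,2), of m N] assms by simp
  qed
qed

lemma star_upper_bound:
  assumes "m \<ge> 1"
  shows "alice_has_winning_strategy (complete_bipartite 1 m) (2 * m)"
proof (rule alice_wins_if_no_draw)
  show "\<not> contains_copy ({} :: nat set set) (complete_bipartite 1 m)"
    using assms contains_star_iff[of "{}" "2 * m" m] by simp
next
  fix h assume h: "full_play (2 * m) h"
  then have "deg (blue h) 0 + deg (red h) 0 = 2 * m - 1"
    using deg_blue_red[of h 0] deg_complete_edges[of 0 "2 * m"] assms
    unfolding full_play_def by simp
  \<comment> \<open>Pigeonhole: \<open>2 * m - 1\<close> edges in two colours contain
    \<open>m\<close> of the same colour.\<close>
  then have "m \<le> deg (blue h) 0 \<or> m \<le> deg (red h) 0" by linarith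
  moreover have "blue h \<subseteq> complete_edges (2 * m)" "red h \<subseteq> complete_edges (2 * m)"
    using h blue_Un_red[of h] unfolding full_play_def by auto
  moreover have "contains_copy C (complete_bipartite 1 m)"
    if "C \<subseteq> complete_edges (2 * m)" "m \<le> deg C 0" for C
    unfolding contains_star_iff[OF that(1) assms] using that(2) assms
    by (intro exI[of _ 0]) simp
  ultimately show "contains_copy (blue h) (complete_bipartite 1 m) \<or>
      contains_copy (red h) (complete_bipartite 1 m)"
    by blast
qed

theorem theorem4:
  fixes n :: nat
  assumes "n \<ge> 3"
  shows "(\<exists>N. alice_has_winning_strategy (complete_bipartite 1 (n - 1)) N) \<and>
    2 * real n - 2 - sqrt ((4 * real n - 8) * ln (4 * real n - 4))
      \<le> real (achievement_number (complete_bipartite 1 (n - 1))) \<and>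
    real (achievement_number (complete_bipartite 1 (n - 1))) \<le> 2 * real n - 2"
proof -
  let ?W = "alice_has_winning_strategy (complete_bipartite 1 (n - 1))"
    and ?a = "achievement_number (complete_bipartite 1 (n - 1))"
  have up: "?W (2 * (n - 1))" using assms by (intro star_upper_bound) simp
  \<comment> \<open>Since a winning \<open>N\<close> exists, \<open>LEAST\<close> denotes a winning
    number, to which the lower bound applies.\<close>
  then have "?W ?a" unfolding achievement_number_def by (rule LeastI)
  then have "2 * real (n - 1) - sqrt ((4 * real (n - 1) - 4) * ln (4 * real (n - 1))) \<le> real ?a"
    using assms by (intro star_lower_bound) simp_all
  moreover have "?a \<le> 2 * (n - 1)" unfolding achievement_number_def using up by (rule Least_le)
  then have "real ?a \<le> 2 * real (n - 1)" by linarith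
  moreover have "real (n - 1) = real n - 1" using assms by simp
  ultimately show ?thesis using up by (auto simp: algebra_simps)
qed

end
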